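(* Let $(V,g)$ be a Euclidean real vector space of dimension $n$ and let $\mathcal D=\bigoplus_{p,q\ge0}D^{p,q}$ be its algebra of double forms. For all $\omega_1,\omega_2\in\mathcal D$, $$\langle g\omega_1,\omega_2\rangle=\langle\omega_1,c\,\omega_2\rangle,$$ that is, the contraction map $c$ is the adjoint of multiplication by $g$.
   Context: $D^{p,q}=\Lambda^pV^*\otimes\Lambda^qV^*$, identified with bilinear forms $\Lambda^pV\times\Lambda^qV\to\mathbb R$ (wedges of distinct elements of a dual basis evaluate to $1$ on the corresponding wedges of basis vectors). The product is $(\theta_1\otimes\theta_2)\cdot(\theta_3\otimes\theta_4)=(\theta_1\wedge\theta_3)\otimes(\theta_2\wedge\theta_4)$, and $g=\sum_{i=1}^n e_i\otimes e_i\in D^{1,1}$ for an orthonormal basis $(e_i)$ of $V^*$. The contraction $c:D^{p,q}\to D^{p-1,q-1}$ is $0$ if $p=0$ or $q=0$, and otherwise $c\omega(x_1\wedge\dots\wedge x_{p-1},y_1\wedge\dots\wedge y_{q-1})=\sum_{j=1}^n\omega(e_j\wedge x_1\wedge\dots\wedge x_{p-1},e_j\wedge y_1\wedge\dots\wedge y_{q-1})$ with $(e_j)$ an orthonormal basis of $V$. The inner product $\langle\cdot,\cdot\rangle$ on $D^{p,q}$ is the tensor product of the standard inner products on $\Lambda^pV^*$ and $\Lambda^qV^*$ (wedges of distinct orthonormal basis elements with increasing indices are orthonormal), extended to $\mathcal D$ by declaring $D^{p,q}\perp D^{r,s}$ if $(p,q)\ne(r,s)$. *)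

theory Defs
  imports "HOL-Analysis.Analysis" "HOL-Combinatorics.Multiset_Permutations"
begin

(* V is the whole type 'a::real_inner.  Finite dimension is imposed by the existence of a finite
   orthonormal basis; unlike the class euclidean_space this does not exclude n = 0. *)

definition orthonormal_basis :: "nat \<Rightarrow> (nat \<Rightarrow> 'a::real_inner) \<Rightarrow> bool" where
  "orthonormal_basis n e \<longleftrightarrow>
     (\<forall>i<n. \<forall>j<n. e i \<bullet> e j = (if i = j then 1 else 0)) \<and> span (e ` {..<n}) = UNIV"

(* A linear form on Lambda^p V is an alternating p-linear form on V, that is, a function on lists
   of length p.  It is extended by 0 to lists of any other length, so that it is determined by its
   values on Lambda^p V. *)

definition alternating_form :: "nat \<Rightarrow> ('a::real_inner list \<Rightarrow> real) \<Rightarrow> bool" where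
  "alternating_form p \<alpha> \<longleftrightarrow>
     (\<forall>us vs. length us + length vs + 1 = p \<longrightarrow> linear (\<lambda>x. \<alpha> (us @ x # vs))) \<and>
     (\<forall>xs. \<not> distinct xs \<longrightarrow> \<alpha> xs = 0) \<and>
     (\<forall>xs. length xs \<noteq> p \<longrightarrow> \<alpha> xs = 0)"

type_synonym 'a double_form = "'a list \<Rightarrow> 'a list \<Rightarrow> real"

definition double_forms :: "nat \<Rightarrow> nat \<Rightarrow> 'a::real_inner double_form set" where
  "double_forms p q =
     {\<omega>. (\<forall>ys. alternating_form p (\<lambda>xs. \<omega> xs ys)) \<and> (\<forall>xs. alternating_form q (\<lambda>ys. \<omega> xs ys))}"

(* An element of the direct sum is the single function on pairs of lists whose restriction to
   lists of lengths p and q is its component in D^{p,q}. *)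

definition component :: "nat \<Rightarrow> nat \<Rightarrow> 'a double_form \<Rightarrow> 'a double_form" where
  "component p q \<omega> = (\<lambda>xs ys. if length xs = p \<and> length ys = q then \<omega> xs ys else 0)"

definition double_form_algebra :: "'a::real_inner double_form set" where
  "double_form_algebra =
     {\<omega>. (\<forall>p q. component p q \<omega> \<in> double_forms p q) \<and>
         finite {(p, q). component p q \<omega> \<noteq> (\<lambda>_ _. 0)}}"

definition tensor :: "('a list \<Rightarrow> real) \<Rightarrow> ('a list \<Rightarrow> real) \<Rightarrow> 'a double_form" where
  "tensor \<alpha> \<beta> = (\<lambda>xs ys. \<alpha> xs * \<beta> ys)"

(* Sign of the shuffle that moves the positions in A, in order, in front of the remaining
   positions below k. *)

definition shuffle_sign :: "nat \<Rightarrow> nat set \<Rightarrow> real" where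
  "shuffle_sign k A = (- 1) ^ card {(i, j). i \<in> A \<and> j \<in> {..<k} - A \<and> j < i}"

(* The shuffle formula for the exterior product, normalised without factorials, so that wedges of
   dual basis elements evaluate to 1 on the corresponding wedges of basis vectors.  The summands
   in which A has the wrong size vanish. *)

definition wedge :: "('a list \<Rightarrow> real) \<Rightarrow> ('a list \<Rightarrow> real) \<Rightarrow> ('a list \<Rightarrow> real)" where
  "wedge \<alpha> \<beta> = (\<lambda>xs. \<Sum>A\<in>Pow {..<length xs}.
     shuffle_sign (length xs) A * \<alpha> (nths xs A) * \<beta> (nths xs (- A)))"

(* The bilinear extension of the rule dform_mult_tensor below. *)

definition dform_mult :: "'a double_form \<Rightarrow> 'a double_form \<Rightarrow> 'a double_form" where
  "dform_mult \<omega> \<eta> = (\<lambda>xs ys. \<Sum>A\<in>Pow {..<length xs}. \<Sum>B\<in>Pow {..<length ys}.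
     shuffle_sign (length xs) A * shuffle_sign (length ys) B *
     \<omega> (nths xs A) (nths ys B) * \<eta> (nths xs (- A)) (nths ys (- B)))"

lemma dform_mult_tensor:
  "dform_mult (tensor \<alpha>1 \<alpha>2) (tensor \<alpha>3 \<alpha>4) = tensor (wedge \<alpha>1 \<alpha>3) (wedge \<alpha>2 \<alpha>4)"
  unfolding dform_mult_def tensor_def wedge_def sum_product
  by (intro ext sum.cong refl) (simp add: mult_ac)

definition covector :: "'a::real_inner \<Rightarrow> 'a list \<Rightarrow> real" where
  "covector u = (\<lambda>xs. case xs of [x] \<Rightarrow> u \<bullet> x | _ \<Rightarrow> 0)"

definition metric_form :: "nat \<Rightarrow> (nat \<Rightarrow> 'a::real_inner) \<Rightarrow> 'a double_form" where
  "metric_form n e = (\<lambda>xs ys. \<Sum>i<n. tensor (covector (e i)) (covector (e i)) xs ys)"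

(* The components in D^{0,q} and D^{p,0} are never used on the right, hence are sent to 0. *)

definition contraction :: "nat \<Rightarrow> (nat \<Rightarrow> 'a) \<Rightarrow> 'a double_form \<Rightarrow> 'a double_form" where
  "contraction n e \<omega> = (\<lambda>xs ys. \<Sum>j<n. \<omega> (e j # xs) (e j # ys))"

(* For I = {i_1 < ... < i_p}, the list representing e_{i_1} \<and> ... \<and> e_{i_p}. *)

definition basis_list :: "(nat \<Rightarrow> 'a) \<Rightarrow> nat set \<Rightarrow> 'a list" where
  "basis_list e I = map e (sorted_list_of_set I)"

(* The numbers \<omega> (basis_list e I) (basis_list e J) are the coordinates of \<omega> in the basis formed
   by the tensor products of wedges of dual basis elements; this basis of the whole direct sum is
   declared orthonormal, so components of different bidegree are orthogonal. *)

definition dform_inner ::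
  "nat \<Rightarrow> (nat \<Rightarrow> 'a) \<Rightarrow> 'a double_form \<Rightarrow> 'a double_form \<Rightarrow> real" where
  "dform_inner n e \<omega> \<eta> = (\<Sum>I\<in>Pow {..<n}. \<Sum>J\<in>Pow {..<n}.
     \<omega> (basis_list e I) (basis_list e J) * \<eta> (basis_list e I) (basis_list e J))"


(* The wedges of dual basis elements with increasing indices, and the orthonormality of their
   tensor products. *)

definition wedge_list :: "'a::real_inner list \<Rightarrow> 'a list \<Rightarrow> real" where
  "wedge_list us = foldr (\<lambda>u. wedge (covector u)) us (\<lambda>xs. of_bool (xs = []))"

lemma length_nths_subset:
  assumes "A \<subseteq> {..<length xs}"
  shows "length (nths xs A) = card A"
proof -
  have "{i. i < length xs \<and> i \<in> A} = A" using assms by auto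
  then show ?thesis by (simp add: length_nths)
qed

lemma nths_singleton_index: "j < length xs \<Longrightarrow> nths xs {j} = [xs ! j]"
proof (induction xs arbitrary: j)
  case (Cons x xs)
  then show ?case
    by (cases j) (simp_all add: nths_Cons)
qed simp

lemma shuffle_sign_0: "shuffle_sign k {0} = 1"
proof -
  have "{(i, j). i \<in> {0::nat} \<and> j \<in> {..<k} - {0} \<and> j < i} = {}" by auto
  then show ?thesis unfolding shuffle_sign_def by (simp only: card.empty power_0)
qed

lemma wedge_list_basis_sorted:
  assumes e: "orthonormal_basis n e"
    and "sorted_wrt (<) is" "set is \<subseteq> {..<n}" "sorted_wrt (<) ks" "set ks \<subseteq> {..<n}"
  shows "wedge_list (map e is) (map e ks) = of_bool (is = ks)"
  using assms(2-)
proof (induction "is" arbitrary: ks)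
  case Nil
  then show ?case by (auto simp: wedge_list_def)
next
  case (Cons i "is")
  let ?W = "wedge_list (map e is)"
  let ?t = "\<lambda>A. shuffle_sign (length ks) A * covector (e i) (nths (map e ks) A)
              * ?W (nths (map e ks) (- A))"
  have W: "wedge_list (map e (i # is)) (map e ks) = (\<Sum>A\<in>Pow {..<length ks}. ?t A)"
    by (simp add: wedge_list_def wedge_def)
  have sub: "sorted_wrt (<) (nths ks B)" "set (nths ks B) \<subseteq> {..<n}" for B
    using Cons.prems
    by (auto simp: strict_sorted_iff sorted_nths distinct_nthsI dest: in_set_nthsD)
  have W_sub: "?W (nths (map e ks) B) = of_bool (is = nths ks B)" for B
    using Cons.IH[OF _ _ sub[of B]] Cons.prems by (simp add: nths_map)
  have off: "?t A = 0" if A: "A \<in> Pow {..<length ks} - {{0}}" for A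
  proof (rule ccontr)
    assume nz: "?t A \<noteq> 0"
    then have c: "covector (e i) (nths (map e ks) A) \<noteq> 0" and w: "is = nths ks (- A)"
      using W_sub[of "- A"] by (auto split: if_splits)
    from c have "length (nths (map e ks) A) = 1"
      by (auto simp: covector_def split: list.splits)
    then have "card A = 1" using A length_nths_subset[of A "map e ks"] by simp
    then obtain j where j: "A = {j}" by (auto simp: card_1_singleton_iff)
    have jl: "j < length ks" and j0: "j \<noteq> 0" using A j by auto
    have "e i \<bullet> e (ks ! j) \<noteq> 0"
      using c jl by (simp add: j nths_singleton_index covector_def)
    moreover have "ks ! j < n" using Cons.prems jl nth_mem by blast
    moreover have "i < n" using Cons.prems by simp
    ultimately have ij: "i = ks ! j" using e by (auto simp: orthonormal_basis_def split: if_splits)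
    have "ks ! 0 \<in> set is"
      unfolding w set_nths using j j0 jl by force
    then have "i < ks ! 0" using Cons.prems by auto
    moreover have "ks ! 0 < ks ! j" using Cons.prems j0 jl by (simp add: sorted_wrt_nth_less)
    ultimately show False using ij by simp
  qed
  show ?case
  proof (cases ks)
    case Nil
    then show ?thesis unfolding W by (simp add: covector_def)
  next
    case (Cons k ks')
    have "(\<Sum>A\<in>Pow {..<length ks}. ?t A) = ?t {0}"
      using off Cons
      by (subst sum.mono_neutral_right[of "Pow {..<length ks}" "{{0}}" ?t]) auto
    moreover have "nths ks (- {0}) = ks'"
      using Cons by (simp add: nths_Cons nths_all)
    moreover have "k < n" "i < n" using Cons Cons.prems by auto
    ultimately show ?thesis
      unfolding W using W_sub[of "- {0}"] e Cons
      by (auto simp: shuffle_sign_0 nths_singleton_index covector_def orthonormal_basis_def)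
  qed
qed

lemma wedge_list_basis:
  assumes "orthonormal_basis n e" "I \<subseteq> {..<n}" "K \<subseteq> {..<n}"
  shows "wedge_list (basis_list e I) (basis_list e K) = of_bool (I = K)"
proof -
  have fin: "finite I" "finite K" using assms finite_subset by blast+
  have "wedge_list (basis_list e I) (basis_list e K)
      = of_bool (sorted_list_of_set I = sorted_list_of_set K)"
    unfolding basis_list_def using assms fin by (intro wedge_list_basis_sorted) auto
  then show ?thesis using fin sorted_list_of_set_inject by (auto simp: of_bool_def)
qed

lemma dform_inner_basis:
  assumes e: "orthonormal_basis n e"
    and "I \<subseteq> {..<n}" "J \<subseteq> {..<n}" "K \<subseteq> {..<n}" "L \<subseteq> {..<n}"
  shows "dform_inner n e
           (tensor (wedge_list (basis_list e I)) (wedge_list (basis_list e J)))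
           (tensor (wedge_list (basis_list e K)) (wedge_list (basis_list e L)))
         = of_bool (I = K \<and> J = L)"
proof -
  have "dform_inner n e
           (tensor (wedge_list (basis_list e I)) (wedge_list (basis_list e J)))
           (tensor (wedge_list (basis_list e K)) (wedge_list (basis_list e L)))
      = (\<Sum>M\<in>Pow {..<n}. \<Sum>N\<in>Pow {..<n}.
           (if M = I then of_bool (I = K) else 0) * (if N = J then of_bool (J = L) else 0))"
    unfolding dform_inner_def tensor_def
    using assms by (intro sum.cong refl) (auto simp: wedge_list_basis)
  also have "\<dots> = (\<Sum>M\<in>Pow {..<n}. if M = I then of_bool (I = K) else 0) *
                  (\<Sum>N\<in>Pow {..<n}. if N = J then of_bool (J = L) else 0)"
    by (simp only: sum_product)
  also have "\<dots> = of_bool (I = K \<and> J = L)"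
    using assms by (simp add: sum.delta)
  finally show ?thesis .
qed

(* Independence of the orthonormal basis. *)

lemma orthonormal_basis_expand:
  assumes e: "orthonormal_basis n e"
  shows "(\<Sum>i<n. (e i \<bullet> x) *\<^sub>R e i) = x"
proof -
  define y where "y = x - (\<Sum>i<n. (e i \<bullet> x) *\<^sub>R e i)"
  have "y \<bullet> e k = 0" if "k < n" for k
  proof -
    have "(\<Sum>i<n. (e i \<bullet> x) * (e i \<bullet> e k)) = (\<Sum>i<n. if i = k then e k \<bullet> x else 0)"
      using e that by (intro sum.cong) (auto simp: orthonormal_basis_def)
    also have "\<dots> = e k \<bullet> x" using that by simp
    finally show ?thesis
      by (simp add: y_def inner_diff_left inner_sum_left inner_commute[of x])
  qed
  then have "orthogonal y y"
    using e orthogonal_to_span[of y "e ` {..<n}" y]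
    by (auto simp: orthonormal_basis_def orthogonal_def)
  then show ?thesis by (simp add: y_def orthogonal_self)
qed

lemma trace_basis_independent:
  assumes e: "orthonormal_basis n e" and f: "orthonormal_basis m f"
    and l1: "\<And>y. linear (\<lambda>x. b x y :: real)" and l2: "\<And>x. linear (b x)"
  shows "(\<Sum>i<n. b (e i) (e i)) = (\<Sum>j<m. b (f j) (f j))"
proof -
  have 1: "b (e i) (e i) = (\<Sum>j<m. (f j \<bullet> e i) * b (e i) (f j))" for i
    using arg_cong[OF orthonormal_basis_expand[OF f, of "e i"], of "b (e i)"]
    by (simp add: linear_sum[OF l2] linear_cmul[OF l2])
  have 2: "b (f j) (f j) = (\<Sum>i<n. (e i \<bullet> f j) * b (e i) (f j))" for j
    using arg_cong[OF orthonormal_basis_expand[OF e, of "f j"], of "\<lambda>x. b x (f j)"]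
    by (simp add: linear_sum[OF l1] linear_cmul[OF l1])
  show ?thesis
    unfolding 1 2 by (subst sum.swap) (simp add: inner_commute)
qed

lemma metric_form_basis_independent:
  assumes "orthonormal_basis n e" "orthonormal_basis m f"
  shows "metric_form n e = metric_form m f"
proof (intro ext)
  fix xs ys :: "'a list"
  show "metric_form n e xs ys = metric_form m f xs ys"
    unfolding metric_form_def tensor_def
    by (rule trace_basis_independent[OF assms])
       (auto simp: covector_def inner_add_left algebra_simps intro!: linearI split: list.splits)
qed

lemma double_form_linear:
  assumes "\<omega> \<in> double_form_algebra"
  shows "linear (\<lambda>x. \<omega> (us @ x # vs) ys)" "linear (\<lambda>y. \<omega> xs (us @ y # vs))"
proof -
  have c: "component p q \<omega> \<in> double_forms p q" for p q
    using assms by (simp add: double_form_algebra_def)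
  have "linear (\<lambda>x. component (length us + length vs + 1) (length ys) \<omega> (us @ x # vs) ys)"
    using c[of "length us + length vs + 1" "length ys"]
    by (simp add: double_forms_def alternating_form_def)
  then show "linear (\<lambda>x. \<omega> (us @ x # vs) ys)" by (simp add: component_def)
  have "linear (\<lambda>y. component (length xs) (length us + length vs + 1) \<omega> xs (us @ y # vs))"
    using c[of "length xs" "length us + length vs + 1"]
    by (simp add: double_forms_def alternating_form_def)
  then show "linear (\<lambda>y. \<omega> xs (us @ y # vs))" by (simp add: component_def)
qed

lemma double_form_alternating:
  assumes "\<omega> \<in> double_form_algebra"
  shows "\<not> distinct xs \<Longrightarrow> \<omega> xs ys = 0" "\<not> distinct ys \<Longrightarrow> \<omega> xs ys = 0"
proof -
  have "component (length xs) (length ys) \<omega> \<in> double_forms (length xs) (length ys)"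
    using assms by (simp add: double_form_algebra_def)
  then have "\<not> distinct xs \<or> \<not> distinct ys \<Longrightarrow> component (length xs) (length ys) \<omega> xs ys = 0"
    by (auto simp: double_forms_def alternating_form_def)
  then show "\<not> distinct xs \<Longrightarrow> \<omega> xs ys = 0" "\<not> distinct ys \<Longrightarrow> \<omega> xs ys = 0"
    by (auto simp: component_def)
qed

lemma contraction_basis_independent:
  assumes "orthonormal_basis n e" "orthonormal_basis m f" and w: "\<omega> \<in> double_form_algebra"
  shows "contraction n e \<omega> = contraction m f \<omega>"
proof (intro ext)
  fix xs ys :: "'a list"
  show "contraction n e \<omega> xs ys = contraction m f \<omega> xs ys"
    unfolding contraction_def
    using double_form_linear[OF w, where us = "[]"]
    by (intro trace_basis_independent[OF assms(1,2)]) auto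
qed

definition index_lists :: "nat \<Rightarrow> nat \<Rightarrow> nat list set" where
  "index_lists n p = {ks. set ks \<subseteq> {..<n} \<and> length ks = p}"

lemma sum_index_lists_Suc:
  "(\<Sum>ks\<in>index_lists n (Suc p). F ks) = (\<Sum>k<n. \<Sum>ks\<in>index_lists n p. F (k # ks) :: real)"
proof -
  have "index_lists n (Suc p) = (\<lambda>(k, ks). k # ks) ` ({..<n} \<times> index_lists n p)"
    by (force simp: index_lists_def length_Suc_conv image_iff)
  moreover have "inj_on (\<lambda>(k, ks). k # ks) ({..<n} \<times> index_lists n p)"
    by (auto simp: inj_on_def)
  ultimately show ?thesis
    by (simp add: sum.reindex sum.cartesian_product case_prod_unfold)
qed

lemma linear_mult_const:
  fixes h :: "'a::real_vector \<Rightarrow> real"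
  assumes "linear h"
  shows "linear (\<lambda>x. h x * c)" "linear (\<lambda>x. c * h x)"
  using assms by (auto simp: linear_iff algebra_simps)

lemma sum_index_lists_basis_independent:
  assumes e: "orthonormal_basis n e" and f: "orthonormal_basis n f"
    and la: "\<And>us vs. linear (\<lambda>x. \<alpha> (us @ x # vs) :: real)"
    and lb: "\<And>us vs. linear (\<lambda>x. \<beta> (us @ x # vs) :: real)"
  shows "(\<Sum>ks\<in>index_lists n p. \<alpha> (us @ map e ks) * \<beta> (us' @ map e ks))
       = (\<Sum>ks\<in>index_lists n p. \<alpha> (us @ map f ks) * \<beta> (us' @ map f ks))"
proof (induction p arbitrary: us us')
  case 0
  have "index_lists n 0 = {[]}" by (auto simp: index_lists_def)
  then show ?case by simp
next
  case (Suc p)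
  have "(\<Sum>ks\<in>index_lists n (Suc p). \<alpha> (us @ map e ks) * \<beta> (us' @ map e ks))
      = (\<Sum>k<n. \<Sum>ks\<in>index_lists n p.
           \<alpha> ((us @ [e k]) @ map f ks) * \<beta> ((us' @ [e k]) @ map f ks))"
    unfolding sum_index_lists_Suc Suc.IH[symmetric] by simp
  also have "\<dots> = (\<Sum>k<n. \<Sum>ks\<in>index_lists n p.
           \<alpha> ((us @ [f k]) @ map f ks) * \<beta> ((us' @ [f k]) @ map f ks))"
    using la lb
    by (intro trace_basis_independent[OF e f, where
          b = "\<lambda>x y. \<Sum>ks\<in>index_lists n p. \<alpha> ((us @ [x]) @ map f ks) * \<beta> ((us' @ [y]) @ map f ks)"]
        linear_compose_sum ballI)
       (simp_all add: linear_mult_const)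
  also have "\<dots> = (\<Sum>ks\<in>index_lists n (Suc p). \<alpha> (us @ map f ks) * \<beta> (us' @ map f ks))"
    unfolding sum_index_lists_Suc by simp
  finally show ?case .
qed

lemma alternating_swap:
  assumes la: "\<And>us vs. linear (\<lambda>x. \<alpha> (us @ x # vs) :: real)"
    and aa: "\<And>xs. \<not> distinct xs \<Longrightarrow> \<alpha> xs = 0"
  shows "\<alpha> (us @ x # y # vs) = - \<alpha> (us @ y # x # vs)"
proof -
  have add1: "\<alpha> (us @ (a + b) # c # vs) = \<alpha> (us @ a # c # vs) + \<alpha> (us @ b # c # vs)" for a b c
    using linear_add[OF la[of us "c # vs"]] by simp
  have add2: "\<alpha> (us @ c # (a + b) # vs) = \<alpha> (us @ c # a # vs) + \<alpha> (us @ c # b # vs)" for a b c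
    using linear_add[OF la[of "us @ [c]" vs]] by simp
  have z: "\<alpha> (us @ a # a # vs) = 0" for a by (rule aa) simp
  have "0 = \<alpha> (us @ (x + y) # (x + y) # vs)" by (simp add: z)
  also have "\<dots> = \<alpha> (us @ x # y # vs) + \<alpha> (us @ y # x # vs)"
    unfolding add1 add2 by (simp add: z)
  finally show ?thesis by simp
qed

lemma swap_invariant_mset:
  assumes sw: "\<And>us x y vs. \<phi> (us @ x # y # vs) = \<phi> (us @ y # x # vs)"
    and "mset xs = mset ys"
  shows "\<phi> (ps @ xs) = \<phi> (ps @ ys)"
proof -
  have move: "\<phi> (ps @ x # us @ vs) = \<phi> (ps @ us @ x # vs)" for ps x us vs
  proof (induction us arbitrary: ps)
    case (Cons u us)
    show ?case using sw[of ps x u "us @ vs"] Cons.IH[of "ps @ [u]"] by simp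
  qed simp
  show ?thesis using assms(2)
  proof (induction xs arbitrary: ps ys)
    case (Cons x xs)
    then have "x \<in> set ys" by (metis list.set_intros(1) mset_eq_setD)
    then obtain us vs where ys: "ys = us @ x # vs" by (meson split_list)
    then have "mset xs = mset (us @ vs)" using Cons.prems by simp
    from Cons.IH[OF this, of "ps @ [x]"] show ?case by (simp add: ys move)
  qed simp
qed

lemma sum_index_lists_alternating:
  assumes la: "\<And>us vs. linear (\<lambda>x. \<alpha> (us @ x # vs) :: real)"
    and lb: "\<And>us vs. linear (\<lambda>x. \<beta> (us @ x # vs) :: real)"
    and aa: "\<And>xs. \<not> distinct xs \<Longrightarrow> \<alpha> xs = 0" and ab: "\<And>xs. \<not> distinct xs \<Longrightarrow> \<beta> xs = 0"
  shows "(\<Sum>ks\<in>index_lists n p. \<alpha> (map e ks) * \<beta> (map e ks))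
       = fact p * (\<Sum>I | I \<subseteq> {..<n} \<and> card I = p. \<alpha> (basis_list e I) * \<beta> (basis_list e I))"
proof -
  let ?\<phi> = "\<lambda>xs. \<alpha> xs * \<beta> xs"
  let ?S = "{I. I \<subseteq> {..<n} \<and> card I = p}"
  have fL: "finite (index_lists n p)"
    unfolding index_lists_def by (rule finite_lists_length_eq) simp
  have "?\<phi> (us @ x # y # vs) = ?\<phi> (us @ y # x # vs)" for us x y vs
    using alternating_swap[of \<alpha> us x y vs, OF la aa] alternating_swap[of \<beta> us x y vs, OF lb ab]
    by simp
  then have inv: "?\<phi> xs = ?\<phi> ys" if "mset xs = mset ys" for xs ys
    using swap_invariant_mset[of ?\<phi> xs ys "[]"] that by simp
  have fS: "finite ?S" by (rule finite_subset[of _ "Pow {..<n}"]) auto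
  have "(\<Sum>ks\<in>index_lists n p. ?\<phi> (map e ks))
      = (\<Sum>ks\<in>{ks\<in>index_lists n p. distinct ks}. ?\<phi> (map e ks))"
    using fL aa by (intro sum.mono_neutral_right) (auto simp: distinct_map)
  also have "{ks\<in>index_lists n p. distinct ks} = (\<Union>I\<in>?S. permutations_of_set I)"
    by (auto simp: index_lists_def permutations_of_set_def distinct_card)
  also have "(\<Sum>ks\<in>\<dots>. ?\<phi> (map e ks)) = (\<Sum>I\<in>?S. \<Sum>ks\<in>permutations_of_set I. ?\<phi> (map e ks))"
    using fS by (intro sum.UNION_disjoint) (simp_all, auto simp: permutations_of_set_def)
  also have "\<dots> = (\<Sum>I\<in>?S. fact p * ?\<phi> (basis_list e I))"
  proof (intro sum.cong refl)
    fix I assume I: "I \<in> ?S"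
    then have fI: "finite I" using finite_subset by blast
    have "?\<phi> (map e ks) = ?\<phi> (basis_list e I)" if "ks \<in> permutations_of_set I" for ks
    proof -
      have "mset ks = mset (sorted_list_of_set I)"
        using that fI by (subst set_eq_iff_mset_eq_distinct[symmetric])
          (auto simp: permutations_of_set_def)
      then show ?thesis
        unfolding basis_list_def by (intro inv) (metis mset_map)
    qed
    then show "(\<Sum>ks\<in>permutations_of_set I. ?\<phi> (map e ks)) = fact p * ?\<phi> (basis_list e I)"
      using I fI by simp
  qed
  finally show ?thesis by (simp add: sum_distrib_left)
qed

lemma sum_Pow_basis_independent:
  assumes e: "orthonormal_basis n e" and f: "orthonormal_basis n f"
    and la: "\<And>us vs. linear (\<lambda>x. \<alpha> (us @ x # vs) :: real)"
    and lb: "\<And>us vs. linear (\<lambda>x. \<beta> (us @ x # vs) :: real)"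
    and aa: "\<And>xs. \<not> distinct xs \<Longrightarrow> \<alpha> xs = 0" and ab: "\<And>xs. \<not> distinct xs \<Longrightarrow> \<beta> xs = 0"
  shows "(\<Sum>I\<in>Pow {..<n}. \<alpha> (basis_list e I) * \<beta> (basis_list e I))
       = (\<Sum>I\<in>Pow {..<n}. \<alpha> (basis_list f I) * \<beta> (basis_list f I))"
proof -
  have split: "(\<Sum>I\<in>Pow {..<n}. F I :: real) = (\<Sum>p\<le>n. \<Sum>I | I \<subseteq> {..<n} \<and> card I = p. F I)" for F
  proof -
    have "card ` Pow {..<n} \<subseteq> {..n}"
      using card_mono[of "{..<n}"] by fastforce
    from sum.group[of "Pow {..<n}" "{..n}" card F, OF _ _ this]
    show ?thesis by (simp add: Pow_def)
  qed
  have "(\<Sum>I | I \<subseteq> {..<n} \<and> card I = p. \<alpha> (basis_list e I) * \<beta> (basis_list e I))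
      = (\<Sum>I | I \<subseteq> {..<n} \<and> card I = p. \<alpha> (basis_list f I) * \<beta> (basis_list f I))" for p
    using sum_index_lists_basis_independent[OF e f la lb, where p = p and us = "[]" and us' = "[]"]
    
    by (simp add: sum_index_lists_alternating[of \<alpha> \<beta>, OF la lb aa ab])
  then show ?thesis unfolding split by simp
qed

lemma dform_inner_basis_independent:
  assumes e: "orthonormal_basis n e" and f: "orthonormal_basis n f"
    and w: "\<omega> \<in> double_form_algebra" and h: "\<eta> \<in> double_form_algebra"
  shows "dform_inner n e \<omega> \<eta> = dform_inner n f \<omega> \<eta>"
proof -
  note l = double_form_linear[OF w] double_form_linear[OF h]
  note a = double_form_alternating[OF w] double_form_alternating[OF h]
  have "dform_inner n e \<omega> \<eta> = (\<Sum>I\<in>Pow {..<n}. \<Sum>J\<in>Pow {..<n}.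
      \<omega> (basis_list e I) (basis_list f J) * \<eta> (basis_list e I) (basis_list f J))"
    unfolding dform_inner_def
    by (intro sum.cong refl sum_Pow_basis_independent[OF e f] l a)
  also have "\<dots> = (\<Sum>J\<in>Pow {..<n}. \<Sum>I\<in>Pow {..<n}.
      \<omega> (basis_list e I) (basis_list f J) * \<eta> (basis_list e I) (basis_list f J))"
    by (rule sum.swap)
  also have "\<dots> = (\<Sum>J\<in>Pow {..<n}. \<Sum>I\<in>Pow {..<n}.
      \<omega> (basis_list f I) (basis_list f J) * \<eta> (basis_list f I) (basis_list f J))"
    by (intro sum.cong refl sum_Pow_basis_independent[OF e f,
          where \<alpha> = "\<lambda>xs. \<omega> xs _" and \<beta> = "\<lambda>xs. \<eta> xs _"] l a)
  also have "\<dots> = dform_inner n f \<omega> \<eta>"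
    unfolding dform_inner_def by (rule sum.swap)
  finally show ?thesis .
qed

end

theory Submission
  imports Defs
begin

text \<open>Multiplication by \<open>g\<close> is the sum over \<open>i\<close> of left exterior multiplication by \<open>e\<^sub>i\<close> in both
  arguments, and contraction is the sum over \<open>i\<close> of inserting \<open>e\<^sub>i\<close> in front of both arguments.
  So it suffices that, in one argument, exterior multiplication by \<open>e\<^sub>i\<close> is adjoint to insertion of
  \<open>e\<^sub>i\<close>: on the basis element \<open>e\<^sub>I\<close> with \<open>i \<in> I\<close> both produce the same sign, that of moving \<open>e\<^sub>i\<close>
  to the front of \<open>e\<^sub>I\<close>, and \<open>I \<mapsto> I - {i}\<close> matches the two sums.\<close>

text \<open>The pairs counted are the inversions undone by bringing position \<open>j\<close> to the
  front, past the \<open>j\<close> positions before it.\<close>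

lemma shuffle_sign_singleton:
  assumes "j < k"
  shows "shuffle_sign k {j} = (- 1) ^ j"
proof -
  have "{(i, l). i \<in> {j} \<and> l \<in> {..<k} - {j} \<and> l < i} = Pair j ` {..<j}"
    using assms by auto
  then show ?thesis
    unfolding shuffle_sign_def by (simp add: card_image inj_on_def)
qed

lemma nths_Compl_singleton:
  "nths (us @ x # vs) (- {length us}) = us @ vs"
proof -
  have "nths us (- {length us}) = us"
    by (rule nths_all) simp
  moreover have "nths vs {j. Suc j + length us \<in> - {length us}} = vs"
    by (rule nths_all) simp
  ultimately show ?thesis
    by (simp add: nths_append nths_Cons)
qed

text \<open>\<open>covector u\<close> vanishes on lists of length other than one, so only singletons
  \<open>A\<close> survive in the shuffle sum: a Laplace expansion.\<close>

lemma wedge_covector: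
  "wedge (covector u) \<alpha> xs =
     (\<Sum>j<length xs. (- 1) ^ j * (u \<bullet> xs ! j) * \<alpha> (nths xs (- {j})))"
proof -
  let ?t = "\<lambda>A. shuffle_sign (length xs) A * covector u (nths xs A) * \<alpha> (nths xs (- A))"
  have "?t A = 0" if A: "A \<in> Pow {..<length xs} - (\<lambda>j. {j}) ` {..<length xs}" for A
  proof -
    have "length (nths xs A) \<noteq> 1"
      using A length_nths_subset[of A xs] by (auto simp: card_1_singleton_iff)
    then show ?thesis
      by (auto simp: covector_def split: list.splits)
  qed
  then have "wedge (covector u) \<alpha> xs = (\<Sum>A\<in>(\<lambda>j. {j}) ` {..<length xs}. ?t A)"
    unfolding wedge_def by (intro sum.mono_neutral_right) auto
  also have "\<dots> = (\<Sum>j<length xs. ?t {j})"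
    by (subst sum.reindex) (auto simp: inj_on_def)
  also have "\<dots> = (\<Sum>j<length xs. (- 1) ^ j * (u \<bullet> xs ! j) * \<alpha> (nths xs (- {j})))"
    by (intro sum.cong refl)
      (simp add: shuffle_sign_singleton nths_singleton_index covector_def)
  finally show ?thesis .
qed

lemma wedge_covector_orthogonal:
  assumes "\<And>x. x \<in> set xs \<Longrightarrow> u \<bullet> x = 0"
  shows "wedge (covector u) \<alpha> xs = 0"
  unfolding wedge_covector using assms by simp

text \<open>Every term of \<open>wedge_covector\<close> except the one removing \<open>x\<close>
  pairs \<open>u\<close> with a vector orthogonal to it.\<close>

lemma wedge_covector_split:
  assumes "\<And>y. y \<in> set us \<union> set vs \<Longrightarrow> u \<bullet> y = 0"
  shows "wedge (covector u) \<alpha> (us @ x # vs) = (- 1) ^ length us * (u \<bullet> x) * \<alpha> (us @ vs)"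
proof -
  let ?xs = "us @ x # vs"
  have "u \<bullet> ?xs ! j = 0" if "j < length ?xs" "j \<noteq> length us" for j
    using that assms by (auto simp: nth_append nth_Cons' not_less)
  then have "wedge (covector u) \<alpha> ?xs =
      (\<Sum>j\<in>{length us}. (- 1) ^ j * (u \<bullet> ?xs ! j) * \<alpha> (nths ?xs (- {j})))"
    unfolding wedge_covector by (intro sum.mono_neutral_right) auto
  then show ?thesis
    by (simp add: nths_Compl_singleton)
qed

text \<open>Each of the \<open>length us\<close> adjacent transpositions changes the sign. The
  induction peels \<open>us\<close> from the right, since \<open>x\<close> passes its last entry
  first.\<close>

lemma alternating_move_front:
  assumes la: "\<And>us vs. linear (\<lambda>x. \<alpha> (us @ x # vs) :: real)"
    and aa: "\<And>xs. \<not> distinct xs \<Longrightarrow> \<alpha> xs = 0"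
  shows "\<alpha> (us @ x # vs) = (- 1) ^ length us * \<alpha> (x # us @ vs)"
proof (induction us arbitrary: vs rule: rev_induct)
  case (snoc u us)
  have "\<alpha> (us @ u # x # vs) = - \<alpha> (us @ x # u # vs)"
    by (rule alternating_swap[OF la aa])
  then show ?case
    using snoc.IH[of "u # vs"] by simp
qed simp

text \<open>Deleting an entry from an increasing list keeps the order of the others, so the same
  \<open>us\<close> and \<open>vs\<close> serve both index sets.\<close>

lemma basis_list_split:
  assumes "finite I" "i \<in> I"
  obtains us vs where "basis_list e I = map e us @ e i # map e vs"
    "basis_list e (I - {i}) = map e us @ map e vs" "set us \<union> set vs = I - {i}"
proof -
  obtain us vs where s: "sorted_list_of_set I = us @ i # vs" "i \<notin> set us"
    using assms by (metis set_sorted_list_of_set split_list_first)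
  then have r: "sorted_list_of_set (I - {i}) = us @ vs"
    using assms by (simp add: sorted_list_of_set_remove remove1_append)
  have "set us \<union> set vs = I - {i}"
    using assms arg_cong[OF r, of set] by simp
  with s r show ?thesis
    by (intro that[of us vs]) (simp_all add: basis_list_def)
qed

text \<open>\<open>\<alpha>\<close> is an arbitrary function on lists, so it may itself contain a
  wedge in the other argument of a double form.\<close>

lemma wedge_covector_adjoint:
  assumes e: "orthonormal_basis n e" and i: "i < n"
    and la: "\<And>us vs. linear (\<lambda>x. \<beta> (us @ x # vs) :: real)"
    and aa: "\<And>xs. \<not> distinct xs \<Longrightarrow> \<beta> xs = 0"
  shows "(\<Sum>I\<in>Pow {..<n}. wedge (covector (e i)) \<alpha> (basis_list e I) * \<beta> (basis_list e I))
       = (\<Sum>I\<in>Pow {..<n}. \<alpha> (basis_list e I) * \<beta> (e i # basis_list e I))"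
    (is "sum ?f _ = sum ?g _")
proof -
  let ?P = "{I \<in> Pow {..<n}. i \<in> I}" and ?N = "{I \<in> Pow {..<n}. i \<notin> I}"
  have ortho: "e i \<bullet> e k = (if k = i then 1 else 0)" if "k < n" for k
    using e i that by (auto simp: orthonormal_basis_def)
  have set_basis: "set (basis_list e I) = e ` I" if "I \<in> Pow {..<n}" for I
    using that finite_subset[of I] by (simp add: basis_list_def)
  \<comment> \<open>For \<open>i\<close> outside \<open>I\<close>, \<open>e i\<close> is orthogonal
    to every entry of the list.\<close>
  have "wedge (covector (e i)) \<alpha> (basis_list e I) = 0" if "I \<in> Pow {..<n} - ?P" for I
    using that by (intro wedge_covector_orthogonal) (auto simp: set_basis ortho)
  then have "sum ?f (Pow {..<n}) = sum ?f ?P"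
    by (intro sum.mono_neutral_right) auto
  also have "\<dots> = (\<Sum>I\<in>?P. ?g (I - {i}))"
  proof (intro sum.cong refl)
    fix I assume I: "I \<in> ?P"
    then have "finite I" "i \<in> I"
      using finite_subset[of I] by auto
    then obtain us vs where s: "basis_list e I = map e us @ e i # map e vs"
      "basis_list e (I - {i}) = map e us @ map e vs" "set us \<union> set vs = I - {i}"
      using basis_list_split by metis
    have "e i \<bullet> y = 0" if "y \<in> set (map e us) \<union> set (map e vs)" for y
    proof -
      have "y \<in> e ` (set us \<union> set vs)"
        using that by auto
      then obtain k where "k \<in> I - {i}" "y = e k"
        unfolding s(3) by blast
      then show ?thesis
        using I ortho by auto
    qed
    then have "wedge (covector (e i)) \<alpha> (basis_list e I)
        = (- 1) ^ length us * \<alpha> (basis_list e (I - {i}))"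
      unfolding s by (subst wedge_covector_split) (auto simp: ortho i)
    moreover have "\<beta> (basis_list e I) = (- 1) ^ length us * \<beta> (e i # basis_list e (I - {i}))"
      unfolding s by (subst alternating_move_front[OF la aa]) auto
    \<comment> \<open>The sign from the wedge and the sign from moving \<open>e i\<close> to the
      front cancel.\<close>
    moreover have "(- 1 :: real) ^ length us * (- 1) ^ length us = 1"
      by (simp flip: power_mult_distrib)
    ultimately show "?f I = ?g (I - {i})"
      by simp
  qed
  also have "\<dots> = sum ?g ?N"
    using i by (intro sum.reindex_bij_witness[where i = "insert i" and j = "\<lambda>I. I - {i}"]) auto
  \<comment> \<open>If \<open>i \<in> I\<close>, then \<open>e i\<close> occurs twice in
    \<open>e i # basis_list e I\<close>, and \<open>\<beta>\<close> vanishes there.\<close>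
  also have "\<dots> = sum ?g (Pow {..<n})"
    using aa by (intro sum.mono_neutral_left) (auto simp: set_basis)
  finally show ?thesis .
qed

text \<open>Each summand of the metric form is a tensor product, so the double shuffle sum splits
  into one wedge per argument; the inner one acts on the second argument with \<open>us\<close> held
  fixed.\<close>

lemma dform_mult_metric_form:
  "dform_mult (metric_form n e) \<omega> xs ys =
     (\<Sum>i<n. wedge (covector (e i)) (\<lambda>us. wedge (covector (e i)) (\<omega> us) ys) xs)"
proof -
  let ?t = "\<lambda>A B i. shuffle_sign (length xs) A * covector (e i) (nths xs A) *
    (shuffle_sign (length ys) B * covector (e i) (nths ys B) * \<omega> (nths xs (- A)) (nths ys (- B)))"
  have "dform_mult (metric_form n e) \<omega> xs ys =
      (\<Sum>A\<in>Pow {..<length xs}. \<Sum>B\<in>Pow {..<length ys}. \<Sum>i<n. ?t A B i)"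
    unfolding dform_mult_def metric_form_def tensor_def sum_distrib_left sum_distrib_right
    by (intro sum.cong refl) (simp add: mult_ac)
  also have "\<dots> = (\<Sum>A\<in>Pow {..<length xs}. \<Sum>i<n. \<Sum>B\<in>Pow {..<length ys}. ?t A B i)"
    by (intro sum.cong refl sum.swap)
  also have "\<dots> = (\<Sum>i<n. \<Sum>A\<in>Pow {..<length xs}. \<Sum>B\<in>Pow {..<length ys}. ?t A B i)"
    by (rule sum.swap)
  finally show ?thesis
    by (simp only: wedge_def sum_distrib_left)
qed

theorem theorem3p1:
  fixes n :: nat and e :: "nat \<Rightarrow> 'a::real_inner" and \<omega>1 \<omega>2 :: "'a double_form"
  assumes "orthonormal_basis n e"
    and "\<omega>1 \<in> double_form_algebra" and "\<omega>2 \<in> double_form_algebra"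
  shows "dform_inner n e (dform_mult (metric_form n e) \<omega>1) \<omega>2
       = dform_inner n e \<omega>1 (contraction n e \<omega>2)"
proof -
  note l = double_form_linear[OF assms(3)] and a = double_form_alternating[OF assms(3)]
  let ?P = "Pow {..<n}" and ?b = "basis_list e" and ?w = "\<lambda>i. wedge (covector (e i))"
  \<comment> \<open>The index sets have all sizes, so all bidegrees are handled at once.\<close>
  have "dform_inner n e (dform_mult (metric_form n e) \<omega>1) \<omega>2
      = (\<Sum>I\<in>?P. \<Sum>J\<in>?P. \<Sum>i<n. ?w i (\<lambda>us. ?w i (\<omega>1 us) (?b J)) (?b I) * \<omega>2 (?b I) (?b J))"
    unfolding dform_inner_def dform_mult_metric_form by (simp only: sum_distrib_right)
  also have "\<dots> = (\<Sum>I\<in>?P. \<Sum>i<n. \<Sum>J\<in>?P.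
      ?w i (\<lambda>us. ?w i (\<omega>1 us) (?b J)) (?b I) * \<omega>2 (?b I) (?b J))"
    by (intro sum.cong refl sum.swap)
  also have "\<dots> = (\<Sum>i<n. \<Sum>I\<in>?P. \<Sum>J\<in>?P.
      ?w i (\<lambda>us. ?w i (\<omega>1 us) (?b J)) (?b I) * \<omega>2 (?b I) (?b J))"
    by (rule sum.swap)
  also have "\<dots> = (\<Sum>i<n. \<Sum>I\<in>?P. \<Sum>J\<in>?P. \<omega>1 (?b I) (?b J) * \<omega>2 (e i # ?b I) (e i # ?b J))"
  proof (rule sum.cong[OF refl])
    fix i assume "i \<in> {..<n}"
    then have i: "i < n" by simp
    \<comment> \<open>With the sum over \<open>I\<close> inside, adjointness in the first argument
      applies for each fixed \<open>J\<close>.\<close>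
    have "(\<Sum>I\<in>?P. \<Sum>J\<in>?P. ?w i (\<lambda>us. ?w i (\<omega>1 us) (?b J)) (?b I) * \<omega>2 (?b I) (?b J))
        = (\<Sum>J\<in>?P. \<Sum>I\<in>?P. ?w i (\<lambda>us. ?w i (\<omega>1 us) (?b J)) (?b I) * \<omega>2 (?b I) (?b J))"
      by (rule sum.swap)
    also have "\<dots> = (\<Sum>J\<in>?P. \<Sum>I\<in>?P. ?w i (\<omega>1 (?b I)) (?b J) * \<omega>2 (e i # ?b I) (?b J))"
      by (intro sum.cong refl wedge_covector_adjoint[OF assms(1) i, where \<beta> = "\<lambda>xs. \<omega>2 xs _"] l a)
    also have "\<dots> = (\<Sum>I\<in>?P. \<Sum>J\<in>?P. ?w i (\<omega>1 (?b I)) (?b J) * \<omega>2 (e i # ?b I) (?b J))"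
      by (rule sum.swap)
    also have "\<dots> = (\<Sum>I\<in>?P. \<Sum>J\<in>?P. \<omega>1 (?b I) (?b J) * \<omega>2 (e i # ?b I) (e i # ?b J))"
      by (intro sum.cong refl wedge_covector_adjoint[OF assms(1) i] l a)
    finally show "(\<Sum>I\<in>?P. \<Sum>J\<in>?P. ?w i (\<lambda>us. ?w i (\<omega>1 us) (?b J)) (?b I) * \<omega>2 (?b I) (?b J))
        = (\<Sum>I\<in>?P. \<Sum>J\<in>?P. \<omega>1 (?b I) (?b J) * \<omega>2 (e i # ?b I) (e i # ?b J))" .
  qed
  also have "\<dots> = (\<Sum>I\<in>?P. \<Sum>i<n. \<Sum>J\<in>?P. \<omega>1 (?b I) (?b J) * \<omega>2 (e i # ?b I) (e i # ?b J))"
    by (rule sum.swap)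
  also have "\<dots> = (\<Sum>I\<in>?P. \<Sum>J\<in>?P. \<Sum>i<n. \<omega>1 (?b I) (?b J) * \<omega>2 (e i # ?b I) (e i # ?b J))"
    by (intro sum.cong refl sum.swap)
  also have "\<dots> = dform_inner n e \<omega>1 (contraction n e \<omega>2)"
    unfolding dform_inner_def contraction_def by (simp only: sum_distrib_left)
  finally show ?thesis .
qed

end
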